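(* Let $X$ be a locally compact separable metrizable space, let $Z\subseteq X$ be compact, and let $\mathcal U=(\mathfrak P,\{\mathcal U_{\mathfrak p}\},\{\Phi_{\mathfrak p\mathfrak q}\})$ be an abstract good coordinate system of $Z$ in the weak sense. Then there exists a shrinking $\mathcal U^0$ of $\mathcal U$ which is an abstract good coordinate system of $Z$ in the strong sense.
   Context: An abstract K-chart of $X$ is a triple $(U,S,\psi)$ where $U$ is a locally compact separable metrizable space, $S\subseteq U$ is closed, and $\psi:S\to X$ is a homeomorphism onto an open subset of $X$. Given abstract K-charts $\mathcal U_i=(U_i,S_i,\psi_i)$ ($i=1,2$), a coordinate change from $\mathcal U_1$ to $\mathcal U_2$ is a pair $(U_{21},\varphi_{21})$ with: (1) $U_{21}\subseteq U_1$ open; (2) $\varphi_{21}:U_{21}\to U_2$ a topological embedding; (3) $S_1\cap U_{21}=\varphi_{21}^{-1}(S_2)$ and $\psi_2\circ\varphi_{21}=\psi_1$ on $S_1\cap U_{21}$; (4) $\psi_1(S_1\cap U_{21})=\psi_1(S_1)\cap\psi_2(S_2)$. An abstract good coordinate system of $Z$ in the weak sense is $(\mathfrak P,\{\mathcal U_{\mathfrak p}\},\{\Phi_{\mathfrak p\mathfrak q}\})$ where: (1) $\mathfrak P$ is a finite partially ordered set; (2) each $\mathcal U_{\mathfrak p}=(U_{\mathfrak p},S_{\mathfrak p},\psi_{\mathfrak p})$ is an abstract K-chart; (3) for $\mathfrak q\le\mathfrak p$, $\Phi_{\mathfrak p\mathfrak q}=(U_{\mathfrak p\mathfrak q},\varphi_{\mathfrak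 p\mathfrak q})$ is a coordinate change from $\mathcal U_{\mathfrak q}$ to $\mathcal U_{\mathfrak p}$, with $U_{\mathfrak p\mathfrak p}=U_{\mathfrak p}$ and $\varphi_{\mathfrak p\mathfrak p}=\mathrm{id}$; (4) if $\mathfrak r\le\mathfrak q\le\mathfrak p$ then $\varphi_{\mathfrak p\mathfrak r}=\varphi_{\mathfrak p\mathfrak q}\circ\varphi_{\mathfrak q\mathfrak r}$ on $\varphi_{\mathfrak q\mathfrak r}^{-1}(U_{\mathfrak p\mathfrak q})\cap U_{\mathfrak p\mathfrak r}$; (5) if $\psi_{\mathfrak p}(S_{\mathfrak p})\cap\psi_{\mathfrak q}(S_{\mathfrak q})\neq\emptyset$ then $\mathfrak p\le\mathfrak q$ or $\mathfrak q\le\mathfrak p$; (6) $\bigcup_{\mathfrak p}\psi_{\mathfrak p}(S_{\mathfrak p})\supseteq Z$. On $\coprod_{\mathfrak p}U_{\mathfrak p}$ define a relation $\sim$: for $x\in U_{\mathfrak p}$, $y\in U_{\mathfrak q}$, $x\sim y$ iff (a) $\mathfrak p=\mathfrak q$ and $x=y$, or (b) $\mathfrak p\le\mathfrak q$, $x\in U_{\mathfrak q\mathfrak p}$ and $y=\varphi_{\mathfrak q\mathfrak p}(x)$, or (c) $\mathfrak q\le\mathfrak p$, $y\in U_{\mathfrak p\mathfrak q}$ and $x=\varphi_{\mathfrak p\mathfrak q}(y)$. The system is an abstract good coordinate system of $Z$ in the strong sense if it is one in the weak sense and moreover (7) $\sim$ is an equivalence relation and (8) the quotient $(\coprod_{\mathfrak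 p}U_{\mathfrak p})/\sim$ with the quotient topology is Hausdorff. For an open subset $V$ of a separable metrizable space $U$, write $V\Subset U$ ($V$ is a shrinking of $U$) if the closure of $V$ in $U$ is compact. For an abstract K-chart $\mathcal U=(U,S,\psi)$ and open $U_0\subseteq U$, $\mathcal U|_{U_0}=(U_0,S\cap U_0,\psi|_{S\cap U_0})$; it is a shrinking of $\mathcal U$ if $U_0\Subset U$. An abstract good coordinate system $\mathcal U^0=(\mathfrak P,\{\mathcal U^0_{\mathfrak p}\},\{\Phi^0_{\mathfrak p\mathfrak q}\})$ of $Z$ in the weak sense (same $\mathfrak P$) is a shrinking of $\mathcal U$ if each $\mathcal U^0_{\mathfrak p}$ is a shrinking of $\mathcal U_{\mathfrak p}$, and for $\mathfrak q\le\mathfrak p$ the domain of $\Phi^0_{\mathfrak p\mathfrak q}$ is a shrinking ($\Subset$) of the domain $U_{\mathfrak p\mathfrak q}$ of $\Phi_{\mathfrak p\mathfrak q}$ and $\varphi^0_{\mathfrak p\mathfrak q}$ is the restriction of $\varphi_{\mathfrak p\mathfrak q}$. *)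

theory Defs
  imports "HOL-Analysis.Analysis"
begin

text \<open>Standing convention: all the spaces U_p of the charts are topologies on one common
  carrier type 'u (any family of spaces embeds into such a type); a coordinate system is
  indexed by a finite set P with a partial order le on P.  The disjoint union of the U_p
  is the library's sum_topology, whose points are pairs (p, x).\<close>

definition lcsm_space :: "'a topology \<Rightarrow> bool" where
  "lcsm_space T \<longleftrightarrow> locally_compact_space T \<and> separable_space T \<and> metrizable_space T"

definition K_chart :: "'x topology \<Rightarrow> 'u topology \<Rightarrow> 'u set \<Rightarrow> ('u \<Rightarrow> 'x) \<Rightarrow> bool" where
  "K_chart X U S psi \<longleftrightarrow>
     lcsm_space U \<and> closedin U S \<and>
     openin X (psi ` S) \<and>
     homeomorphic_map (subtopology U S) (subtopology X (psi ` S)) psi"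

definition coord_change ::
  "'u topology \<Rightarrow> 'u set \<Rightarrow> ('u \<Rightarrow> 'x) \<Rightarrow> 'u topology \<Rightarrow> 'u set \<Rightarrow> ('u \<Rightarrow> 'x)
    \<Rightarrow> 'u set \<Rightarrow> ('u \<Rightarrow> 'u) \<Rightarrow> bool" where
  "coord_change U1 S1 psi1 U2 S2 psi2 U21 phi21 \<longleftrightarrow>
     openin U1 U21 \<and>
     embedding_map (subtopology U1 U21) U2 phi21 \<and>
     S1 \<inter> U21 = {x \<in> U21. phi21 x \<in> S2} \<and>
     (\<forall>x \<in> S1 \<inter> U21. psi2 (phi21 x) = psi1 x) \<and>
     psi1 ` (S1 \<inter> U21) = psi1 ` S1 \<inter> psi2 ` S2"

definition partial_order_on_set :: "'p set \<Rightarrow> ('p \<Rightarrow> 'p \<Rightarrow> bool) \<Rightarrow> bool" where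
  "partial_order_on_set P le \<longleftrightarrow>
     (\<forall>p\<in>P. le p p) \<and>
     (\<forall>p\<in>P. \<forall>q\<in>P. le p q \<and> le q p \<longrightarrow> p = q) \<and>
     (\<forall>p\<in>P. \<forall>q\<in>P. \<forall>r\<in>P. le p q \<and> le q r \<longrightarrow> le p r)"

text \<open>Abstract good coordinate system of Z in the weak sense.
  Upq p q and phi p q are the domain and map of the coordinate change Phi_pq
  from U_q to U_p (for q \<le> p).\<close>
definition gcs_weak ::
  "'x topology \<Rightarrow> 'x set \<Rightarrow> 'p set \<Rightarrow> ('p \<Rightarrow> 'p \<Rightarrow> bool) \<Rightarrow> ('p \<Rightarrow> 'u topology) \<Rightarrow> ('p \<Rightarrow> 'u set)
    \<Rightarrow> ('p \<Rightarrow> 'u \<Rightarrow> 'x) \<Rightarrow> ('p \<Rightarrow> 'p \<Rightarrow> 'u set) \<Rightarrow> ('p \<Rightarrow> 'p \<Rightarrow> 'u \<Rightarrow> 'u) \<Rightarrow> bool" where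
  "gcs_weak X Z P le U S psi Upq phi \<longleftrightarrow>
     finite P \<and> partial_order_on_set P le \<and>
     (\<forall>p\<in>P. K_chart X (U p) (S p) (psi p)) \<and>
     (\<forall>p\<in>P. \<forall>q\<in>P. le q p \<longrightarrow>
        coord_change (U q) (S q) (psi q) (U p) (S p) (psi p) (Upq p q) (phi p q)) \<and>
     (\<forall>p\<in>P. Upq p p = topspace (U p) \<and> (\<forall>x\<in>topspace (U p). phi p p x = x)) \<and>
     (\<forall>p\<in>P. \<forall>q\<in>P. \<forall>r\<in>P. le r q \<and> le q p \<longrightarrow>
        (\<forall>x \<in> Upq q r \<inter> Upq p r. phi q r x \<in> Upq p q \<longrightarrow>
            phi p r x = phi p q (phi q r x))) \<and>
     (\<forall>p\<in>P. \<forall>q\<in>P. psi p ` S p \<inter> psi q ` S q \<noteq> {} \<longrightarrow> le p q \<or> le q p) \<and>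
     Z \<subseteq> (\<Union>p\<in>P. psi p ` S p)"

definition gcs_rel ::
  "'p set \<Rightarrow> ('p \<Rightarrow> 'p \<Rightarrow> bool) \<Rightarrow> ('p \<Rightarrow> 'u topology) \<Rightarrow> ('p \<Rightarrow> 'p \<Rightarrow> 'u set)
    \<Rightarrow> ('p \<Rightarrow> 'p \<Rightarrow> 'u \<Rightarrow> 'u) \<Rightarrow> (('p \<times> 'u) \<times> ('p \<times> 'u)) set" where
  "gcs_rel P le U Upq phi =
     {((p, x), (q, y)) | p x q y.
        p \<in> P \<and> q \<in> P \<and> x \<in> topspace (U p) \<and> y \<in> topspace (U q) \<and>
        ((p = q \<and> x = y) \<or>
         (le p q \<and> x \<in> Upq q p \<and> y = phi q p x) \<or>
         (le q p \<and> y \<in> Upq p q \<and> x = phi p q y))}"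

definition quotient_topology :: "'a topology \<Rightarrow> ('a \<times> 'a) set \<Rightarrow> 'a set topology" where
  "quotient_topology T R =
     topology (\<lambda>W. W \<subseteq> topspace T // R \<and> openin T (\<Union>W))"

definition gcs_strong ::
  "'x topology \<Rightarrow> 'x set \<Rightarrow> 'p set \<Rightarrow> ('p \<Rightarrow> 'p \<Rightarrow> bool) \<Rightarrow> ('p \<Rightarrow> 'u topology) \<Rightarrow> ('p \<Rightarrow> 'u set)
    \<Rightarrow> ('p \<Rightarrow> 'u \<Rightarrow> 'x) \<Rightarrow> ('p \<Rightarrow> 'p \<Rightarrow> 'u set) \<Rightarrow> ('p \<Rightarrow> 'p \<Rightarrow> 'u \<Rightarrow> 'u) \<Rightarrow> bool" where
  "gcs_strong X Z P le U S psi Upq phi \<longleftrightarrow>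
     gcs_weak X Z P le U S psi Upq phi \<and>
     equiv (topspace (sum_topology U P)) (gcs_rel P le U Upq phi) \<and>
     Hausdorff_space (quotient_topology (sum_topology U P) (gcs_rel P le U Upq phi))"

definition shrinking_in :: "'a topology \<Rightarrow> 'a set \<Rightarrow> 'a set \<Rightarrow> bool" where
  "shrinking_in T U V \<longleftrightarrow>
     openin (subtopology T U) V \<and> compactin (subtopology T U) ((subtopology T U) closure_of V)"

end

theory Submission
  imports Defs
begin

text \<open>
  Choose compact \<open>C p \<subseteq> S p\<close> whose images cover \<open>Z\<close>, and restrict the coordinate changes to compact
  neighbourhoods of the overlaps of the \<open>C p\<close>; the union \<open>G\<close> of their graphs and its converse is then closed
  in \<open>T \<times> T\<close>, with \<open>T\<close> the disjoint union of the charts.  At points of the \<open>C p\<close>, being related by \<open>G\<close>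
  means having the same image in \<open>X\<close>, and there the three charts involved in transitivity are linearly
  ordered, so transitivity holds on a neighbourhood of each triple by the cocycle condition and the
  injectivity of the coordinate changes.  A tube argument gives one neighbourhood of the compact set
  \<open>Sigma P C\<close> on which \<open>G\<close> is an equivalence relation.  Inside it choose \<open>C p \<subseteq> V p \<subseteq> L p\<close> with \<open>V p\<close>
  open and \<open>L p\<close> compact: the quotient of the compact Hausdorff space \<open>Sigma P L\<close> by a closed equivalence
  relation is Hausdorff, and the quotient of \<open>Sigma P V\<close> maps injectively and continuously into it.
\<close>

section \<open>Compact sets and quotients\<close>

text \<open>The union of all open boxes on which \<open>Q\<close> holds is open and contains the
  triple product of \<open>C\<close>. Wallace's theorem, applied twice, fits a product of three open
  neighbourhoods of \<open>C\<close> into it, and their intersection serves for all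
  coordinates.\<close>

lemma compact_tube3:
  assumes C: "compactin T C"
    and near: "\<And>a b c. a \<in> C \<Longrightarrow> b \<in> C \<Longrightarrow> c \<in> C \<Longrightarrow>
      \<exists>A B D. openin T A \<and> openin T B \<and> openin T D \<and> a \<in> A \<and> b \<in> B \<and> c \<in> D \<and>
        (\<forall>x\<in>A. \<forall>y\<in>B. \<forall>z\<in>D. Q x y z)"
  obtains N where "openin T N" "C \<subseteq> N" "\<forall>x\<in>N. \<forall>y\<in>N. \<forall>z\<in>N. Q x y z"
proof -
  define \<O> where "\<O> = {A \<times> B \<times> D | A B D. openin T A \<and> openin T B \<and> openin T D \<and>
        (\<forall>x\<in>A. \<forall>y\<in>B. \<forall>z\<in>D. Q x y z)}"
  have op: "openin (prod_topology T (prod_topology T T)) (\<Union>\<O>)"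
    by (rule openin_Union) (auto simp: \<O>_def openin_prod_Times_iff)
  have "C \<times> C \<times> C \<subseteq> \<Union>\<O>"
  proof clarify
    fix a b c assume "a \<in> C" "b \<in> C" "c \<in> C"
    from near[OF this] obtain A B D where "openin T A" "openin T B" "openin T D"
      and "a \<in> A" "b \<in> B" "c \<in> D" and "\<forall>x\<in>A. \<forall>y\<in>B. \<forall>z\<in>D. Q x y z"
      by blast
    then have "A \<times> B \<times> D \<in> \<O>" "(a, b, c) \<in> A \<times> B \<times> D"
      by (auto simp: \<O>_def)
    then show "(a, b, c) \<in> \<Union>\<O>" by blast
  qed
  moreover have "compactin (prod_topology T T) (C \<times> C)"
    by (simp add: compactin_Times C)
  ultimately obtain A E where A: "openin T A" "C \<subseteq> A" and E: "openin (prod_topology T T) E" "C \<times> C \<subseteq> E"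
    and AE: "A \<times> E \<subseteq> \<Union>\<O>"
    using Wallace_theorem_prod_topology[OF C _ op] by metis
  obtain B D where B: "openin T B" "C \<subseteq> B" and D: "openin T D" "C \<subseteq> D" and BD: "B \<times> D \<subseteq> E"
    using Wallace_theorem_prod_topology[OF C C E] by metis
  show thesis
  proof
    show "openin T (A \<inter> (B \<inter> D))" "C \<subseteq> A \<inter> (B \<inter> D)"
      using A B D by auto
    have "Q x y z" if "x \<in> A \<inter> (B \<inter> D)" "y \<in> A \<inter> (B \<inter> D)" "z \<in> A \<inter> (B \<inter> D)" for x y z
    proof -
      have "(x, y, z) \<in> \<Union>\<O>" using that AE BD by blast
      then show ?thesis by (auto simp: \<O>_def)
    qed
    then show "\<forall>x\<in>A \<inter> (B \<inter> D). \<forall>y\<in>A \<inter> (B \<inter> D). \<forall>z\<in>A \<inter> (B \<inter> D). Q x y z"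
      by blast
  qed
qed

text \<open>The open subspace \<open>U\<close> is again locally compact Hausdorff, so
  \<open>K\<close> has a compact neighbourhood inside it; openness of \<open>U\<close> carries
  \<open>V\<close> back to the whole space.\<close>

lemma compact_open_sandwich:
  assumes "locally_compact_space X" "Hausdorff_space X" "compactin X K" "openin X U" "K \<subseteq> U"
  obtains V L where "openin X V" "compactin X L" "K \<subseteq> V" "V \<subseteq> L" "L \<subseteq> U"
proof -
  have lc: "locally_compact_space (subtopology X U)"
    using assms locally_compact_space_open_subset by blast
  have "Hausdorff_space (subtopology X U)"
    by (simp add: assms Hausdorff_space_subtopology)
  moreover have "compactin (subtopology X U) K"
    using assms by (simp add: compactin_subtopology)
  ultimately obtain V L where "openin (subtopology X U) V" "compactin (subtopology X U) L" "K \<subseteq> V" "V \<subseteq> L"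
    using lc locally_compact_space_compact_closed_compact by metis
  then show thesis
    using that assms(4) openin_open_subtopology by (metis compactin_subtopology)
qed

text \<open>Every point of \<open>Z\<close> has a compact neighbourhood inside some
  \<open>Y p\<close>, and finitely many of these cover \<open>Z\<close>.\<close>

lemma compact_cover_refinement:
  assumes lc: "locally_compact_space X" and H: "Hausdorff_space X" and Z: "compactin X Z"
    and op: "\<And>p. p \<in> P \<Longrightarrow> openin X (Y p)" and cover: "Z \<subseteq> (\<Union>p\<in>P. Y p)"
  obtains K where "\<And>p. p \<in> P \<Longrightarrow> compactin X (K p)" "\<And>p. p \<in> P \<Longrightarrow> K p \<subseteq> Y p" "Z \<subseteq> (\<Union>p\<in>P. K p)"
proof -
  have "\<exists>p V L. p \<in> P \<and> openin X V \<and> compactin X L \<and> z \<in> V \<and> V \<subseteq> L \<and> L \<subseteq> Y p" if "z \<in> Z" for z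
  proof -
    obtain p where p: "p \<in> P" "z \<in> Y p" using cover \<open>z \<in> Z\<close> by blast
    have "compactin X {z}"
      using compactin_subset_topspace[OF Z] \<open>z \<in> Z\<close> by auto
    then obtain V L where "openin X V" "compactin X L" "{z} \<subseteq> V" "V \<subseteq> L" "L \<subseteq> Y p"
      using compact_open_sandwich[OF lc H _ op[OF p(1)], of "{z}"] p by auto
    then show ?thesis using p(1) by auto
  qed
  then obtain p V L where pVL: "\<And>z. z \<in> Z \<Longrightarrow>
      p z \<in> P \<and> openin X (V z) \<and> compactin X (L z) \<and> z \<in> V z \<and> V z \<subseteq> L z \<and> L z \<subseteq> Y (p z)"
    by metis
  have "Ball (V ` Z) (openin X) \<and> Z \<subseteq> \<Union>(V ` Z)"
    using pVL by blast
  then have "\<exists>F. finite F \<and> F \<subseteq> V ` Z \<and> Z \<subseteq> \<Union>F"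
    using Z unfolding compactin_def by blast
  then obtain F where F: "finite F" "F \<subseteq> Z" "Z \<subseteq> \<Union>(V ` F)"
    by (metis finite_subset_image)
  \<comment> \<open>The finitely many compact sets are grouped by the index chosen for their centre;
    an index that was never chosen receives the empty set.\<close>
  define K where "K q = \<Union>(L ` {z\<in>F. p z = q})" for q
  show thesis
  proof
    show "compactin X (K q)" if "q \<in> P" for q
      unfolding K_def using F pVL by (intro compactin_Union) auto
    show "K q \<subseteq> Y q" if "q \<in> P" for q
      using F pVL by (force simp: K_def)
    show "Z \<subseteq> (\<Union>q\<in>P. K q)"
    proof
      fix x assume "x \<in> Z"
      then obtain z where "z \<in> F" "x \<in> V z" using F by blast
      then show "x \<in> (\<Union>q\<in>P. K q)"
        using pVL[of z] F by (auto simp: K_def intro!: bexI[of _ "p z"])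
    qed
  qed
qed

section \<open>Disjoint sums and quotients by closed equivalence relations\<close>

lemma Hausdorff_space_sum_topology:
  assumes "\<And>p. p \<in> P \<Longrightarrow> Hausdorff_space (U p)"
  shows "Hausdorff_space (sum_topology U P)"
  unfolding Hausdorff_space_def
proof (intro allI impI; elim conjE)
  fix a b
  assume ab: "a \<in> topspace (sum_topology U P)" "b \<in> topspace (sum_topology U P)" and "a \<noteq> b"
  obtain p x q y where a: "a = (p, x)" and b: "b = (q, y)" by force
  have ne: "(p, x) \<noteq> (q, y)" using \<open>a \<noteq> b\<close> a b by simp
  from ab a b have px: "p \<in> P" "x \<in> topspace (U p)" and qy: "q \<in> P" "y \<in> topspace (U q)" by auto
  have "\<exists>A B. openin (U p) A \<and> openin (U q) B \<and> x \<in> A \<and> y \<in> B \<and> (p = q \<longrightarrow> disjnt A B)"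
  proof (cases "p = q")
    case True
    then have "x \<noteq> y" "y \<in> topspace (U p)" using ne qy by auto
    then show ?thesis
      using assms[OF px(1)] px(2) True unfolding Hausdorff_space_def by blast
  next
    case False
    then show ?thesis
      using px qy by (intro exI[of _ "topspace (U p)"] exI[of _ "topspace (U q)"]) auto
  qed
  then obtain A B where AB: "openin (U p) A" "openin (U q) B" "x \<in> A" "y \<in> B" "p = q \<longrightarrow> disjnt A B"
    by blast
  have "openin (sum_topology U P) (Pair p ` A)"
    using open_map_component_injection[OF px(1), of U] AB(1) by (auto simp: open_map_def)
  moreover have "openin (sum_topology U P) (Pair q ` B)"
    using open_map_component_injection[OF qy(1), of U] AB(2) by (auto simp: open_map_def)
  moreover have "disjnt (Pair p ` A) (Pair q ` B)"
    using AB by (auto simp: disjnt_def)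
  ultimately show "\<exists>V W. openin (sum_topology U P) V \<and> openin (sum_topology U P) W \<and>
      a \<in> V \<and> b \<in> W \<and> disjnt V W"
    using AB unfolding a b by blast
qed

lemma compactin_sum_topology_Sigma:
  assumes "finite P" "\<And>p. p \<in> P \<Longrightarrow> compactin (U p) (L p)"
  shows "compactin (sum_topology U P) (Sigma P L)"
proof -
  have "Sigma P L = (\<Union>p\<in>P. Pair p ` L p)" by auto
  moreover have "compactin (sum_topology U P) (\<Union>p\<in>P. Pair p ` L p)"
    using assms by (auto intro!: compactin_Union image_compactin continuous_map_component_injection)
  ultimately show ?thesis by simp
qed

text \<open>The defining predicate has to be shown to be a topology before \<open>topology\<close>
  returns it. For intersections this uses that distinct classes are disjoint, so that union commutes
  with intersecting two families of classes.\<close>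

lemma openin_quotient_topology:
  assumes R: "equiv (topspace T) R"
  shows "openin (quotient_topology T R) W \<longleftrightarrow> W \<subseteq> topspace T // R \<and> openin T (\<Union>W)"
proof -
  have "istopology (\<lambda>W. W \<subseteq> topspace T // R \<and> openin T (\<Union>W))"
    unfolding istopology_def
  proof (intro conjI allI impI; (elim conjE)?)
    fix W V assume W: "W \<subseteq> topspace T // R" "openin T (\<Union>W)" and V: "V \<subseteq> topspace T // R" "openin T (\<Union>V)"
    have "\<Union>(W \<inter> V) = \<Union>W \<inter> \<Union>V"
      using W V quotient_disj[OF R] by blast
    then show "openin T (\<Union>(W \<inter> V))" using W V by (simp add: openin_Int)
  next
    fix \<K> assume K: "\<forall>K\<in>\<K>. K \<subseteq> topspace T // R \<and> openin T (\<Union>K)"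
    have "\<Union>(\<Union>\<K>) = \<Union>(Union ` \<K>)" by blast
    moreover have "openin T (\<Union>(Union ` \<K>))" using K by (intro openin_Union) auto
    ultimately show "openin T (\<Union>(\<Union>\<K>))" by simp
  qed auto
  then show ?thesis
    by (simp add: quotient_topology_def)
qed

lemma topspace_quotient_topology:
  assumes R: "equiv (topspace T) R"
  shows "topspace (quotient_topology T R) = topspace T // R"
proof
  show "topspace (quotient_topology T R) \<subseteq> topspace T // R"
    using openin_quotient_topology[OF R] openin_topspace by blast
  show "topspace T // R \<subseteq> topspace (quotient_topology T R)"
    by (rule openin_subset) (simp add: openin_quotient_topology[OF R] Union_quotient[OF R])
qed

text \<open>Classes are saturations of points, hence closed, and normality separates them. The
  separating sets are then shrunk to saturated ones, which descend to the quotient.\<close>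

lemma closed_equiv_separation:
  assumes T: "compact_space T" "Hausdorff_space T" and R: "equiv (topspace T) R"
    and cl: "closedin (prod_topology T T) R"
    and a: "a \<in> topspace T" and b: "b \<in> topspace T" and ab: "(a, b) \<notin> R"
  obtains A B where "openin T A" "openin T B" "R `` A \<subseteq> A" "R `` B \<subseteq> B" "a \<in> A" "b \<in> B" "disjnt A B"
proof -
  \<comment> \<open>A saturation is the projection of a closed part of \<open>R\<close>, and
    projecting along a compact factor is a closed map.\<close>
  have sat: "closedin T (R `` F)" if "closedin T F" for F
  proof -
    have "closedin (prod_topology T T) (R \<inter> F \<times> topspace T)"
      using that cl by (simp add: closedin_prod_Times_iff closedin_Int)
    then have "closedin T (snd ` (R \<inter> F \<times> topspace T))"
      using closed_map_snd[OF T(1)] unfolding closed_map_def by blast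
    moreover have "snd ` (R \<inter> F \<times> topspace T) = R `` F"
      using equiv_type[OF R] by force
    ultimately show ?thesis by simp
  qed
  have sym: "sym R" and tr: "trans R" and rf: "refl_on (topspace T) R"
    using R by (auto simp: equiv_def)
  have sub: "R \<subseteq> topspace T \<times> topspace T" using equiv_type[OF R] .
  have cla: "closedin T {c}" if "c \<in> topspace T" for c
    by (intro compactin_imp_closedin[OF T(2)]) (use that in auto)
  have "(a, b) \<in> R" if "(a, c) \<in> R" "(b, c) \<in> R" for c
    using transD[OF tr that(1) symD[OF sym that(2)]] .
  then have "disjnt (R `` {a}) (R `` {b})"
    using ab by (auto simp: disjnt_def)
  moreover have "normal_space T"
    using compact_Hausdorff_or_regular_imp_normal_space T by blast
  ultimately have "\<exists>A B. openin T A \<and> openin T B \<and> R `` {a} \<subseteq> A \<and> R `` {b} \<subseteq> B \<and> disjnt A B"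
    using sat[OF cla[OF a]] sat[OF cla[OF b]] unfolding normal_space_def by blast
  then obtain A' B' where A': "openin T A'" "R `` {a} \<subseteq> A'" and B': "openin T B'" "R `` {b} \<subseteq> B'"
    and dj: "disjnt A' B'"
    by blast
  \<comment> \<open>\<open>core O'\<close> collects the points whose whole class lies in
    \<open>O'\<close>; its complement is the saturation of a closed set.\<close>
  define core where "core O' = topspace T - R `` (topspace T - O')" for O'
  have core: "openin T (core O')" "R `` core O' \<subseteq> core O'" "core O' \<subseteq> O'" if "openin T O'" for O'
  proof -
    show "openin T (core O')"
      unfolding core_def using that sat by (intro openin_diff) auto
    show "R `` core O' \<subseteq> core O'"
    proof clarify
      fix x y assume xy: "(x, y) \<in> R" "x \<in> core O'"
      have "y \<notin> R `` (topspace T - O')"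
      proof
        assume "y \<in> R `` (topspace T - O')"
        then obtain z where "z \<in> topspace T - O'" "(z, y) \<in> R" by blast
        then show False
          using transD[OF tr _ symD[OF sym xy(1)]] xy(2) by (auto simp: core_def)
      qed
      then show "y \<in> core O'" using xy sub by (auto simp: core_def)
    qed
    show "core O' \<subseteq> O'"
      using refl_onD[OF rf] by (auto simp: core_def)
  qed
  show thesis
  proof
    show "a \<in> core A'" "b \<in> core B'"
      using A' B' a b symD[OF sym] unfolding core_def by blast+
    show "disjnt (core A') (core B')"
      using dj core(3)[OF A'(1)] core(3)[OF B'(1)] by (auto simp: disjnt_def)
  qed (use core A' B' in auto)
qed

text \<open>The quotient topology on the classes of \<open>Y\<close> may be finer than the one
  induced from the quotient of \<open>T\<close>, but saturated open sets of \<open>T\<close> still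
  trace saturated open sets on \<open>Y\<close>, and these separate classes.\<close>

lemma Hausdorff_space_quotient_subset:
  assumes T: "compact_space T" "Hausdorff_space T" and R: "equiv (topspace T) R"
    and cl: "closedin (prod_topology T T) R" and Y: "Y \<subseteq> topspace T"
  shows "Hausdorff_space (quotient_topology (subtopology T Y) (R \<inter> Y \<times> Y))"
proof -
  let ?R = "R \<inter> Y \<times> Y" and ?Y = "subtopology T Y"
  have tY: "topspace ?Y = Y" using Y by auto
  have eqY: "equiv (topspace ?Y) ?R"
    using R Y unfolding tY equiv_def refl_on_def sym_def trans_def by blast
  \<comment> \<open>The classes contained in a saturated open \<open>A\<close> have union
    \<open>A \<inter> Y\<close>, so they form an open set of the quotient.\<close>
  have push: "openin (quotient_topology ?Y ?R) {c \<in> Y // ?R. c \<subseteq> A}"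
    if A: "openin T A" "R `` A \<subseteq> A" for A
  proof -
    have "\<Union>{c \<in> Y // ?R. c \<subseteq> A} = A \<inter> Y"
    proof (intro equalityI subsetI)
      fix x assume "x \<in> A \<inter> Y"
      moreover have "x \<in> ?R `` {x}"
        using equiv_class_self[OF eqY, unfolded tY] \<open>x \<in> A \<inter> Y\<close> by blast
      moreover have "?R `` {x} \<subseteq> A" "?R `` {x} \<in> Y // ?R"
        using A(2) \<open>x \<in> A \<inter> Y\<close> by (auto intro: quotientI)
      ultimately show "x \<in> \<Union>{c \<in> Y // ?R. c \<subseteq> A}" by blast
    qed (use eqY in \<open>auto simp: quotient_def\<close>)
    then show ?thesis
      using A(1) unfolding openin_quotient_topology[OF eqY] tY
      by (auto simp: openin_subtopology)
  qed
  show ?thesis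
    unfolding Hausdorff_space_def topspace_quotient_topology[OF eqY] tY
  proof (intro allI impI; elim conjE)
    fix c d assume c: "c \<in> Y // ?R" and d: "d \<in> Y // ?R" and ne: "c \<noteq> d"
    obtain a b where a: "a \<in> Y" "c = ?R `` {a}" and b: "b \<in> Y" "d = ?R `` {b}"
      using c d by (auto simp: quotient_def)
    have "(a, b) \<notin> R"
      using ne a b equiv_class_eq[OF eqY] by blast
    then obtain A B where A: "openin T A" "R `` A \<subseteq> A" "a \<in> A" and B: "openin T B" "R `` B \<subseteq> B" "b \<in> B"
      and dj: "disjnt A B"
      by (rule closed_equiv_separation[OF T R cl subsetD[OF Y a(1)] subsetD[OF Y b(1)]])
    have "disjnt {c \<in> Y // ?R. c \<subseteq> A} {c \<in> Y // ?R. c \<subseteq> B}"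
      using dj in_quotient_imp_non_empty[OF eqY] unfolding tY disjnt_def by blast
    then show "\<exists>V W. openin (quotient_topology ?Y ?R) V \<and> openin (quotient_topology ?Y ?R) W \<and>
        c \<in> V \<and> d \<in> W \<and> disjnt V W"
      using push[OF A(1,2)] push[OF B(1,2)] A(2,3) B(2,3) a b c d
      by (intro exI[of _ "{c \<in> Y // ?R. c \<subseteq> A}"] exI[of _ "{c \<in> Y // ?R. c \<subseteq> B}"]) auto
  qed
qed

section \<open>Relatively compact subsets and restricted embeddings\<close>

text \<open>\<open>K\<close> is compact, hence closed, in the subspace \<open>B\<close>, so it
  contains the closure of \<open>A\<close> taken there.\<close>

lemma shrinking_in_compact:
  assumes H: "Hausdorff_space Y" and A: "openin Y A" "A \<subseteq> K" and K: "compactin Y K" "K \<subseteq> B"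
  shows "shrinking_in Y B A"
  unfolding shrinking_in_def
proof
  have "A \<subseteq> B" using A K by blast
  then show "openin (subtopology Y B) A"
    using A by (metis inf.absorb2 openin_subtopology_Int2)
  have c: "compactin (subtopology Y B) K" using K by (simp add: compactin_subtopology)
  moreover have "closedin (subtopology Y B) K"
    by (rule compactin_imp_closedin[OF Hausdorff_space_subtopology[OF H] c])
  then have "subtopology Y B closure_of A \<subseteq> K"
    using A by (simp add: closure_of_minimal)
  ultimately show "compactin (subtopology Y B) (subtopology Y B closure_of A)"
    by (rule closed_compactin) simp
qed

lemma embedding_map_subset:
  assumes "embedding_map (subtopology Y A) Y' f" "B \<subseteq> A"
  shows "embedding_map (subtopology Y B) Y' f"
proof -
  have "homeomorphic_map (subtopology (subtopology Y A) B)
      (subtopology (subtopology Y' (f ` topspace (subtopology Y A))) (f ` topspace (subtopology Y B))) f"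
    using assms unfolding embedding_map_def
    by (rule_tac homeomorphic_map_subtopologies) (auto dest!: homeomorphic_imp_surjective_map)
  moreover have "f ` topspace (subtopology Y A) \<inter> f ` topspace (subtopology Y B) = f ` topspace (subtopology Y B)"
    "A \<inter> B = B"
    using assms(2) by auto
  ultimately show ?thesis
    unfolding embedding_map_def by (simp add: subtopology_subtopology)
qed

section \<open>The germ of the system along its zero set\<close>

text \<open>Shrinking the domains \<open>Upq p q\<close> to compact sets \<open>D p q\<close> makes the graphs of the coordinate
  changes closed in the disjoint union.  Nothing is lost near the compact sets \<open>C p\<close>, since
  \<open>Om p q\<close> contains every point of \<open>C q\<close> that agrees in \<open>X\<close> with a point of \<open>C p\<close>.\<close>

locale compact_core =
  fixes X :: "'x topology" and Z :: "'x set"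
    and P :: "'p set" and le :: "'p \<Rightarrow> 'p \<Rightarrow> bool"
    and U :: "'p \<Rightarrow> 'u topology" and S :: "'p \<Rightarrow> 'u set" and psi :: "'p \<Rightarrow> 'u \<Rightarrow> 'x"
    and Upq :: "'p \<Rightarrow> 'p \<Rightarrow> 'u set" and phi :: "'p \<Rightarrow> 'p \<Rightarrow> 'u \<Rightarrow> 'u"
    and C :: "'p \<Rightarrow> 'u set" and Om D :: "'p \<Rightarrow> 'p \<Rightarrow> 'u set"
  assumes X: "Hausdorff_space X"
    and weak: "gcs_weak X Z P le U S psi Upq phi"
    and C: "\<And>p. p \<in> P \<Longrightarrow> compactin (U p) (C p)" "\<And>p. p \<in> P \<Longrightarrow> C p \<subseteq> S p"
    and Om_open: "\<And>p q. p \<in> P \<Longrightarrow> q \<in> P \<Longrightarrow> le q p \<Longrightarrow> openin (U q) (Om p q)"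
    and Om_D: "\<And>p q. p \<in> P \<Longrightarrow> q \<in> P \<Longrightarrow> le q p \<Longrightarrow> Om p q \<subseteq> D p q"
    and D_compact: "\<And>p q. p \<in> P \<Longrightarrow> q \<in> P \<Longrightarrow> le q p \<Longrightarrow> compactin (U q) (D p q)"
    and D_Upq: "\<And>p q. p \<in> P \<Longrightarrow> q \<in> P \<Longrightarrow> le q p \<Longrightarrow> D p q \<subseteq> Upq p q"
    and Om_core: "\<And>p q x y. p \<in> P \<Longrightarrow> q \<in> P \<Longrightarrow> le q p \<Longrightarrow> x \<in> C p \<Longrightarrow> y \<in> C q \<Longrightarrow>
      psi p x = psi q y \<Longrightarrow> y \<in> Om p q"
    and core_cover: "Z \<subseteq> (\<Union>p\<in>P. psi p ` C p)"
begin

lemma fin: "finite P"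
  and le_refl: "p \<in> P \<Longrightarrow> le p p"
  and le_antisym: "p \<in> P \<Longrightarrow> q \<in> P \<Longrightarrow> le p q \<Longrightarrow> le q p \<Longrightarrow> p = q"
  and le_trans: "p \<in> P \<Longrightarrow> q \<in> P \<Longrightarrow> r \<in> P \<Longrightarrow> le p q \<Longrightarrow> le q r \<Longrightarrow> le p r"
  and chart: "p \<in> P \<Longrightarrow> K_chart X (U p) (S p) (psi p)"
  and change: "p \<in> P \<Longrightarrow> q \<in> P \<Longrightarrow> le q p \<Longrightarrow>
     coord_change (U q) (S q) (psi q) (U p) (S p) (psi p) (Upq p q) (phi p q)"
  and phi_refl: "p \<in> P \<Longrightarrow> x \<in> topspace (U p) \<Longrightarrow> phi p p x = x"
  and cocycle: "p \<in> P \<Longrightarrow> q \<in> P \<Longrightarrow> r \<in> P \<Longrightarrow> le r q \<Longrightarrow> le q p \<Longrightarrow> x \<in> Upq q r \<Longrightarrow> x \<in> Upq p r \<Longrightarrow>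
     phi q r x \<in> Upq p q \<Longrightarrow> phi p r x = phi p q (phi q r x)"
  and comparable: "p \<in> P \<Longrightarrow> q \<in> P \<Longrightarrow> x \<in> S p \<Longrightarrow> y \<in> S q \<Longrightarrow> psi p x = psi q y \<Longrightarrow> le p q \<or> le q p"
proof -
  have po: "partial_order_on_set P le" using weak by (simp add: gcs_weak_def)
  show "p \<in> P \<Longrightarrow> le p p" "p \<in> P \<Longrightarrow> q \<in> P \<Longrightarrow> le p q \<Longrightarrow> le q p \<Longrightarrow> p = q"
    "p \<in> P \<Longrightarrow> q \<in> P \<Longrightarrow> r \<in> P \<Longrightarrow> le p q \<Longrightarrow> le q r \<Longrightarrow> le p r"
    using po unfolding partial_order_on_set_def by blast+
  show "p \<in> P \<Longrightarrow> q \<in> P \<Longrightarrow> x \<in> S p \<Longrightarrow> y \<in> S q \<Longrightarrow> psi p x = psi q y \<Longrightarrow> le p q \<or> le q p"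
    using weak unfolding gcs_weak_def by blast
  show "p \<in> P \<Longrightarrow> q \<in> P \<Longrightarrow> r \<in> P \<Longrightarrow> le r q \<Longrightarrow> le q p \<Longrightarrow> x \<in> Upq q r \<Longrightarrow> x \<in> Upq p r \<Longrightarrow>
     phi q r x \<in> Upq p q \<Longrightarrow> phi p r x = phi p q (phi q r x)"
    using weak unfolding gcs_weak_def by blast
qed (use weak in \<open>simp_all add: gcs_weak_def\<close>)

lemma chartD:
  assumes "p \<in> P"
  shows U_Hausdorff: "Hausdorff_space (U p)" and U_lc: "locally_compact_space (U p)"
    and U_sep: "separable_space (U p)" and U_metrizable: "metrizable_space (U p)"
    and S_closed: "closedin (U p) (S p)" and psi_S_open: "openin X (psi p ` S p)"
    and psi_homeo: "homeomorphic_map (subtopology (U p) (S p)) (subtopology X (psi p ` S p)) (psi p)"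
    and psi_cont: "continuous_map (subtopology (U p) (S p)) X (psi p)"
    and psi_inj: "inj_on (psi p) (S p)"
proof -
  have K: "K_chart X (U p) (S p) (psi p)" using chart assms by blast
  then show "locally_compact_space (U p)" "separable_space (U p)" "metrizable_space (U p)"
    and S: "closedin (U p) (S p)" "openin X (psi p ` S p)"
    and h: "homeomorphic_map (subtopology (U p) (S p)) (subtopology X (psi p ` S p)) (psi p)"
    by (auto simp: K_chart_def lcsm_space_def)
  then show "Hausdorff_space (U p)"
    using metrizable_imp_Hausdorff_space by blast
  show "continuous_map (subtopology (U p) (S p)) X (psi p)"
    using homeomorphic_imp_continuous_map[OF h] continuous_map_in_subtopology by blast
  have "topspace (subtopology (U p) (S p)) = S p"
    using closedin_subset[OF S(1)] by auto
  then show "inj_on (psi p) (S p)"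
    using homeomorphic_imp_injective_map[OF h] by simp
qed

lemma changeD:
  assumes "p \<in> P" "q \<in> P" "le q p"
  shows Upq_open: "openin (U q) (Upq p q)"
    and phi_emb: "embedding_map (subtopology (U q) (Upq p q)) (U p) (phi p q)"
    and phi_cont: "continuous_map (subtopology (U q) (Upq p q)) (U p) (phi p q)"
    and phi_inj: "inj_on (phi p q) (Upq p q)"
    and phi_S: "y \<in> Upq p q \<Longrightarrow> phi p q y \<in> S p \<longleftrightarrow> y \<in> S q"
    and psi_phi: "y \<in> Upq p q \<Longrightarrow> y \<in> S q \<Longrightarrow> psi p (phi p q y) = psi q y"
proof -
  have cc: "coord_change (U q) (S q) (psi q) (U p) (S p) (psi p) (Upq p q) (phi p q)"
    using change assms by blast
  then show op: "openin (U q) (Upq p q)"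
    and e: "embedding_map (subtopology (U q) (Upq p q)) (U p) (phi p q)"
    by (auto simp: coord_change_def)
  show "continuous_map (subtopology (U q) (Upq p q)) (U p) (phi p q)"
    using e homeomorphic_imp_continuous_map continuous_map_in_subtopology unfolding embedding_map_def by blast
  have ts: "topspace (subtopology (U q) (Upq p q)) = Upq p q"
    using openin_subset[OF op] by auto
  show "inj_on (phi p q) (Upq p q)"
    using e homeomorphic_imp_injective_map ts unfolding embedding_map_def by metis
  show "y \<in> Upq p q \<Longrightarrow> phi p q y \<in> S p \<longleftrightarrow> y \<in> S q"
    "y \<in> Upq p q \<Longrightarrow> y \<in> S q \<Longrightarrow> psi p (phi p q y) = psi q y"
    using cc unfolding coord_change_def by blast+
qed

lemma phi_vimage_open:
  assumes "p \<in> P" "q \<in> P" "le q p" "openin (U p) A" "openin (U q) B" "B \<subseteq> Upq p q"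
  shows "openin (U q) {y \<in> B. phi p q y \<in> A}"
proof -
  have "topspace (subtopology (U q) (Upq p q)) = Upq p q"
    using openin_subset[OF Upq_open] assms by auto
  then have "openin (U q) {y \<in> Upq p q. phi p q y \<in> A}"
    using openin_continuous_map_preimage[OF phi_cont[OF assms(1-3)] assms(4)]
      openin_trans_full[OF _ Upq_open[OF assms(1-3)]] by simp
  then have "openin (U q) (B \<inter> {y \<in> Upq p q. phi p q y \<in> A})"
    using assms(5) by (simp add: openin_Int)
  moreover have "B \<inter> {y \<in> Upq p q. phi p q y \<in> A} = {y \<in> B. phi p q y \<in> A}"
    using assms(6) by auto
  ultimately show ?thesis by simp
qed

section \<open>The closed relation generated by the coordinate changes\<close>

abbreviation T :: "('p \<times> 'u) topology" where "T \<equiv> sum_topology U P"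

text \<open>This plays the role of \<open>gcs_rel\<close> with the compact \<open>D p q\<close> as
  domains. Both orientations are built in, which gives symmetry; the diagonal comes from
  \<open>p = q\<close>, where \<open>phi p p\<close> is the identity, and so covers only points of
  \<open>D p p\<close>.\<close>

definition G :: "(('p \<times> 'u) \<times> ('p \<times> 'u)) set" where
  "G = {((p, x), (q, y)) | p x q y. p \<in> P \<and> q \<in> P \<and>
     ((le q p \<and> y \<in> D p q \<and> x = phi p q y) \<or> (le p q \<and> x \<in> D q p \<and> y = phi q p x))}"

lemma G_sym: "(a, b) \<in> G \<longleftrightarrow> (b, a) \<in> G"
  unfolding G_def by blast

lemma D_topspace: "p \<in> P \<Longrightarrow> q \<in> P \<Longrightarrow> le q p \<Longrightarrow> D p q \<subseteq> topspace (U q)"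
  using D_compact compactin_subset_topspace by blast

text \<open>The opposite orientation can occur only for \<open>p = q\<close> by antisymmetry, and
  there both clauses say the same.\<close>

lemma G_iff:
  assumes "p \<in> P" "q \<in> P" "le q p"
  shows "((p, x), (q, y)) \<in> G \<longleftrightarrow> y \<in> D p q \<and> x = phi p q y"
proof (cases "le p q")
  case True
  then have "p = q" using le_antisym assms by blast
  then show ?thesis
    using assms phi_refl D_topspace[OF assms] unfolding G_def by auto
next
  case False
  then show ?thesis using assms unfolding G_def by auto
qed

lemma T_Hausdorff: "Hausdorff_space T"
  using U_Hausdorff by (rule Hausdorff_space_sum_topology)

text \<open>Each graph is a continuous image of the compact \<open>D p q\<close>, hence closed in
  the Hausdorff product, and there are finitely many pairs of indices.\<close>

lemma G_closed: "closedin (prod_topology T T) G"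
proof -
  define gr where "gr p q = (\<lambda>y. ((p, phi p q y), (q, y))) ` D p q" for p q
  define gr' where "gr' p q = (\<lambda>y. ((q, y), (p, phi p q y))) ` D p q" for p q
  define I where "I = {(p, q). p \<in> P \<and> q \<in> P \<and> le q p}"
  have H: "Hausdorff_space (prod_topology T T)"
    using T_Hausdorff by (simp add: Hausdorff_space_prod_topology)
  have "closedin (prod_topology T T) (gr p q) \<and> closedin (prod_topology T T) (gr' p q)" if "(p, q) \<in> I" for p q
  proof -
    have pq: "p \<in> P" "q \<in> P" "le q p" using that by (auto simp: I_def)
    let ?V = "subtopology (U q) (Upq p q)"
    have "continuous_map ?V T (\<lambda>y. (p, phi p q y))"
      using continuous_map_compose[OF phi_cont[OF pq] continuous_map_component_injection[OF pq(1), of U]]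
      by (simp add: o_def)
    moreover have "continuous_map ?V T (\<lambda>y. (q, y))"
      using continuous_map_component_injection[OF pq(2)] by (rule continuous_map_from_subtopology)
    moreover have "compactin ?V (D p q)"
      using D_compact D_Upq pq by (simp add: compactin_subtopology)
    ultimately show ?thesis
      unfolding gr_def gr'_def
      by (intro conjI compactin_imp_closedin[OF H] image_compactin[where X = ?V] continuous_map_pairedI)
  qed
  moreover have "finite I"
    by (rule finite_subset[of _ "P \<times> P"]) (auto simp: I_def fin)
  ultimately have "closedin (prod_topology T T) (\<Union>(p, q)\<in>I. gr p q \<union> gr' p q)"
    by (intro closedin_Union) (auto intro!: closedin_Un)
  moreover have "G = (\<Union>(p, q)\<in>I. gr p q \<union> gr' p q)"
    unfolding G_def gr_def gr'_def I_def by auto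
  ultimately show ?thesis by simp
qed

lemma C_topspace: "p \<in> P \<Longrightarrow> C p \<subseteq> topspace (U p)"
  using C compactin_subset_topspace by blast

text \<open>Coordinate changes commute with the maps \<open>psi\<close> on the sets
  \<open>S p\<close>, and the core lies in these.\<close>

lemma G_psi:
  assumes "p \<in> P" "q \<in> P" "x \<in> C p" "y \<in> C q" "((p, x), (q, y)) \<in> G"
  shows "psi p x = psi q y"
proof -
  have "x \<in> S p" "y \<in> S q" using assms C(2) by blast+
  consider "le q p" "y \<in> D p q" "x = phi p q y" | "le p q" "x \<in> D q p" "y = phi q p x"
    using assms unfolding G_def by blast
  then show ?thesis
  proof cases
    case 1
    then show ?thesis using psi_phi[of p q y] D_Upq[of p q] assms \<open>y \<in> S q\<close> by auto
  next
    case 2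
    then show ?thesis using psi_phi[of q p x] D_Upq[of q p] assms \<open>x \<in> S p\<close> by auto
  qed
qed

lemma component_open: "p \<in> P \<Longrightarrow> openin (U p) A \<Longrightarrow> openin T (Pair p ` A)"
  using open_map_component_injection[of p P U] by (auto simp: open_map_def)

lemma not_G_near:
  assumes "a \<in> topspace T" "b \<in> topspace T" "(a, b) \<notin> G"
  obtains A B where "openin T A" "openin T B" "a \<in> A" "b \<in> B" "\<forall>x\<in>A. \<forall>y\<in>B. (x, y) \<notin> G"
proof -
  have "openin (prod_topology T T) (topspace T \<times> topspace T - G)"
    using G_closed openin_diff[OF openin_topspace] by (metis topspace_prod_topology)
  then have "\<exists>A B. openin T A \<and> openin T B \<and> a \<in> A \<and> b \<in> B \<and> A \<times> B \<subseteq> topspace T \<times> topspace T - G"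
    using assms unfolding openin_prod_topology_alt by blast
  then show thesis using that by blast
qed

text \<open>Keeping all three implications makes the condition invariant under permutations, so
  transitivity of \<open>G\<close> need only be checked for a chain \<open>r \<le> q \<le> p\<close>.\<close>

definition tri :: "'p \<times> 'u \<Rightarrow> 'p \<times> 'u \<Rightarrow> 'p \<times> 'u \<Rightarrow> bool" where
  "tri a b c \<longleftrightarrow> ((a, b) \<in> G \<and> (b, c) \<in> G \<longrightarrow> (a, c) \<in> G) \<and> ((a, b) \<in> G \<and> (a, c) \<in> G \<longrightarrow> (b, c) \<in> G) \<and>
     ((a, c) \<in> G \<and> (b, c) \<in> G \<longrightarrow> (a, b) \<in> G)"

definition tri_near :: "'p \<times> 'u \<Rightarrow> 'p \<times> 'u \<Rightarrow> 'p \<times> 'u \<Rightarrow> bool" where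
  "tri_near a b c \<longleftrightarrow> (\<exists>A B E. openin T A \<and> openin T B \<and> openin T E \<and> a \<in> A \<and> b \<in> B \<and> c \<in> E \<and>
     (\<forall>x\<in>A. \<forall>y\<in>B. \<forall>z\<in>E. tri x y z))"

text \<open>The two transpositions generate all permutations of the triple, so a linearly ordered
  triple can be brought into the order of a chain.\<close>

lemma tri_near_swap: "tri_near a b c \<Longrightarrow> tri_near b a c" "tri_near a b c \<Longrightarrow> tri_near a c b"
proof -
  have "tri a b c \<Longrightarrow> tri b a c" "tri a b c \<Longrightarrow> tri a c b" for a b c
    unfolding tri_def using G_sym by blast+
  then show "tri_near a b c \<Longrightarrow> tri_near b a c" "tri_near a b c \<Longrightarrow> tri_near a c b"
    unfolding tri_near_def by meson+
qed

text \<open>Injectivity of \<open>psi q\<close> on \<open>S q\<close> gives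
  \<open>phi q r z = y\<close>. Hence all three coordinate changes and the composite
  \<open>phi p q\<close> after \<open>phi q r\<close> are defined on neighbourhoods of
  \<open>y\<close> and \<open>z\<close>, where the cocycle condition applies.\<close>

lemma tri_near_chain:
  assumes pqr: "p \<in> P" "q \<in> P" "r \<in> P" "le r q" "le q p"
    and x: "x \<in> C p" and y: "y \<in> C q" and z: "z \<in> C r"
    and eq: "psi p x = psi q y" "psi q y = psi r z"
  shows "tri_near (p, x) (q, y) (r, z)"
proof -
  have rp: "le r p" using le_trans pqr by blast
  define E where "E = {w \<in> Om q r \<inter> Om p r. phi q r w \<in> Om p q}"
  have yO: "y \<in> Om p q" and zO: "z \<in> Om q r" "z \<in> Om p r"
    using Om_core pqr rp x y z eq by metis+
  have sub: "Om p q \<subseteq> Upq p q" "Om q r \<subseteq> Upq q r" "Om p r \<subseteq> Upq p r"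
    using Om_D D_Upq pqr rp by (meson order_trans)+
  have D: "Om p q \<subseteq> D p q" "Om q r \<subseteq> D q r" "Om p r \<subseteq> D p r"
    using Om_D pqr rp by blast+
  have "z \<in> Upq q r" "z \<in> S r" using zO sub z C(2)[OF pqr(3)] by blast+
  then have "phi q r z \<in> S q" "psi q (phi q r z) = psi q y"
    using phi_S[OF pqr(2,3,4)] psi_phi[OF pqr(2,3,4)] eq by auto
  then have "phi q r z = y"
    using psi_inj[OF pqr(2)] y C(2)[OF pqr(2)] by (meson inj_onD subsetD)
  then have "z \<in> E" using yO zO by (simp add: E_def)
  have "openin (U r) E"
    unfolding E_def using pqr rp sub by (intro phi_vimage_open) (auto intro: Om_open openin_Int)
  \<comment> \<open>With all points in the relevant domains, \<open>G\<close> amounts to the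
    equations \<open>x' = phi p q y'\<close>, \<open>y' = phi q r z'\<close> and
    \<open>x' = phi p r z'\<close>. The cocycle condition yields two of the implications; the one
    concluding \<open>y' = phi q r z'\<close> uses injectivity of \<open>phi p q\<close>.\<close>
  moreover have "tri (p, x') (q, y') (r, z')" if "y' \<in> Om p q" "z' \<in> E" for x' y' z'
  proof -
    have z': "z' \<in> D q r" "z' \<in> D p r" "phi q r z' \<in> D p q" "z' \<in> Upq q r" "z' \<in> Upq p r" "phi q r z' \<in> Upq p q"
      and y': "y' \<in> D p q" "y' \<in> Upq p q"
      using that sub D by (auto simp: E_def)
    have co: "phi p r z' = phi p q (phi q r z')"
      using cocycle pqr z' by blast
    moreover have "phi p q y' = phi p q (phi q r z') \<Longrightarrow> y' = phi q r z'"
      using inj_onD[OF phi_inj[OF pqr(1,2,5)]] y' z' by blast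
    ultimately show ?thesis
      unfolding tri_def G_iff[OF pqr(1,2,5)] G_iff[OF pqr(2,3,4)] G_iff[OF pqr(1,3) rp]
      using z' y' by auto
  qed
  moreover have "x \<in> topspace (U p)" using C_topspace pqr x by blast
  \<comment> \<open>Domains are constrained only in the lower charts, so the neighbourhood of
    \<open>x\<close> can be the whole of \<open>U p\<close>.\<close>
  ultimately show ?thesis
    unfolding tri_near_def using pqr yO \<open>z \<in> E\<close> Om_open[OF pqr(1,2,5)]
    by (intro exI[of _ "Pair p ` topspace (U p)"] exI[of _ "Pair q ` Om p q"] exI[of _ "Pair r ` E"])
       (auto intro!: component_open)
qed

text \<open>A common image in \<open>X\<close> makes the three indices pairwise comparable, so some
  ordering of them is a chain.\<close>

lemma tri_near_core:
  assumes pqr: "p \<in> P" "q \<in> P" "r \<in> P" and x: "x \<in> C p" and y: "y \<in> C q" and z: "z \<in> C r"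
    and eq: "psi p x = psi q y" "psi q y = psi r z"
  shows "tri_near (p, x) (q, y) (r, z)"
proof -
  have S: "x \<in> S p" "y \<in> S q" "z \<in> S r" using pqr x y z C(2) by blast+
  have "le p q \<or> le q p" "le q r \<or> le r q" "le p r \<or> le r p"
    using comparable pqr S eq by metis+
  then consider "le r q" "le q p" | "le q r" "le r p" | "le r p" "le p q" | "le p r" "le r q"
    | "le q p" "le p r" | "le p q" "le q r" by blast
  then show ?thesis
  proof cases
    case 1 then show ?thesis using tri_near_chain assms by metis
  next
    case 2
    then have "tri_near (p, x) (r, z) (q, y)" using tri_near_chain assms by metis
    then show ?thesis by (rule tri_near_swap)
  next
    case 3
    then have "tri_near (q, y) (p, x) (r, z)" using tri_near_chain assms by metis
    then show ?thesis by (rule tri_near_swap)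
  next
    case 4
    then have "tri_near (q, y) (r, z) (p, x)" using tri_near_chain assms by metis
    then show ?thesis by (blast intro: tri_near_swap)
  next
    case 5
    then have "tri_near (r, z) (p, x) (q, y)" using tri_near_chain assms by metis
    then show ?thesis by (blast intro: tri_near_swap)
  next
    case 6
    then have "tri_near (r, z) (q, y) (p, x)" using tri_near_chain assms by metis
    then show ?thesis by (blast intro: tri_near_swap)
  qed
qed

lemma core_compact: "compactin T (Sigma P C)"
  using fin C by (intro compactin_sum_topology_Sigma)

text \<open>Around a triple of core points at which a premise fails, closedness of \<open>G\<close>
  keeps it failing, and transitivity is vacuous. If both premises hold, the three images in
  \<open>X\<close> agree and \<open>tri_near_core\<close> applies. The tube lemma makes the
  neighbourhood uniform.\<close>

lemma G_trans_nbhd: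
  obtains N where "openin T N" "Sigma P C \<subseteq> N"
    "\<forall>a\<in>N. \<forall>b\<in>N. \<forall>c\<in>N. (a, b) \<in> G \<and> (b, c) \<in> G \<longrightarrow> (a, c) \<in> G"
proof -
  let ?Q = "\<lambda>a b c. (a, b) \<in> G \<and> (b, c) \<in> G \<longrightarrow> (a, c) \<in> G"
  have near: "\<exists>A B E. openin T A \<and> openin T B \<and> openin T E \<and> a \<in> A \<and> b \<in> B \<and> c \<in> E \<and>
        (\<forall>x\<in>A. \<forall>y\<in>B. \<forall>z\<in>E. ?Q x y z)"
    if abc: "a \<in> Sigma P C" "b \<in> Sigma P C" "c \<in> Sigma P C" for a b c
  proof -
    obtain p x q y r z where a: "a = (p, x)" and b: "b = (q, y)" and c: "c = (r, z)" by (metis surj_pair)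
    have t: "a \<in> topspace T" "b \<in> topspace T" "c \<in> topspace T" and oT: "openin T (topspace T)"
      using abc compactin_subset_topspace[OF core_compact] by blast+
    have m: "p \<in> P" "q \<in> P" "r \<in> P" "x \<in> C p" "y \<in> C q" "z \<in> C r"
      using abc a b c by auto
    consider "(a, b) \<notin> G" | "(b, c) \<notin> G" | "(a, b) \<in> G" "(b, c) \<in> G" by blast
    then show ?thesis
    proof cases
      case 1
      then obtain A B where "openin T A" "openin T B" "a \<in> A" "b \<in> B" "\<forall>x\<in>A. \<forall>y\<in>B. (x, y) \<notin> G"
        using not_G_near[OF t(1,2)] by blast
      then show ?thesis
        using t(3) oT by (intro exI[of _ A] exI[of _ B] exI[of _ "topspace T"]) simp
    next
      case 2
      then obtain A B where "openin T A" "openin T B" "b \<in> A" "c \<in> B" "\<forall>x\<in>A. \<forall>y\<in>B. (x, y) \<notin> G"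
        using not_G_near[OF t(2,3)] by blast
      then show ?thesis
        using t(1) oT by (intro exI[of _ "topspace T"] exI[of _ A] exI[of _ B]) simp
    next
      case 3
      then have "tri_near a b c"
        using tri_near_core[OF m] G_psi[OF m(1,2,4,5)] G_psi[OF m(2,3,5,6)] a b c by blast
      then obtain A B E where "openin T A" "openin T B" "openin T E" "a \<in> A" "b \<in> B" "c \<in> E"
        and tri: "\<forall>x\<in>A. \<forall>y\<in>B. \<forall>z\<in>E. tri x y z"
        unfolding tri_near_def by (elim exE conjE)
      moreover have "\<forall>x\<in>A. \<forall>y\<in>B. \<forall>z\<in>E. ?Q x y z"
        using tri unfolding tri_def by meson
      ultimately show ?thesis by (intro exI conjI)
    qed
  qed
  obtain N where N: "openin T N" "Sigma P C \<subseteq> N" "\<forall>a\<in>N. \<forall>b\<in>N. \<forall>c\<in>N. ?Q a b c"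
    by (rule compact_tube3[OF core_compact near])
  show thesis by (rule that[OF N])
qed

section \<open>Control of the overlaps near the core\<close>

text \<open>The two alternatives are the two reasons why \<open>y\<close> must survive in the
  shrunken domain: it is identified with \<open>x\<close> by \<open>G\<close>, or it has the same
  image in \<open>X\<close>, as in the overlap condition on coordinate changes.\<close>

definition linked :: "'p \<Rightarrow> 'p \<Rightarrow> 'u \<Rightarrow> 'u \<Rightarrow> bool" where
  "linked p q x y \<longleftrightarrow> (y \<in> D p q \<and> x = phi p q y) \<or> (x \<in> S p \<and> y \<in> S q \<and> psi p x = psi q y)"

lemma psi_nbhd:
  assumes p: "p \<in> P" and x: "x \<in> S p" and Y: "openin X Y" "psi p x \<in> Y"
  obtains A where "openin (U p) A" "x \<in> A" "\<forall>w\<in>A \<inter> S p. psi p w \<in> Y"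
proof -
  have ts: "topspace (subtopology (U p) (S p)) = S p"
    using closedin_subset[OF S_closed[OF p]] by auto
  have "openin (subtopology (U p) (S p)) {w \<in> S p. psi p w \<in> Y}"
    using openin_continuous_map_preimage[OF psi_cont[OF p] Y(1)] unfolding ts .
  then obtain A where A: "openin (U p) A" "{w \<in> S p. psi p w \<in> Y} = A \<inter> S p"
    by (auto simp: openin_subtopology)
  then show thesis using x Y that[of A] by blast
qed

text \<open>If the images agree, the open set \<open>Om p q\<close> is itself a neighbourhood of
  \<open>y\<close>. Otherwise disjoint neighbourhoods in \<open>X\<close> exclude one alternative of
  \<open>linked\<close>, and closedness of \<open>G\<close> excludes the other.\<close>

lemma linked_near:
  assumes pq: "p \<in> P" "q \<in> P" "le q p" and x: "x \<in> C p" and y: "y \<in> C q"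
  obtains A B where "openin (U p) A" "openin (U q) B" "x \<in> A" "y \<in> B"
    "\<forall>v\<in>A. \<forall>w\<in>B. linked p q v w \<longrightarrow> w \<in> Om p q"
proof (cases "psi p x = psi q y")
  case True
  then have "y \<in> Om p q" using Om_core pq x y by blast
  moreover have "x \<in> topspace (U p)" using C_topspace pq x by blast
  ultimately show thesis
    using that[of "topspace (U p)" "Om p q"] Om_open[OF pq] by simp
next
  case False
  have S: "x \<in> S p" "y \<in> S q" using x y C(2) pq by blast+
  have "psi p x \<in> topspace X" "psi q y \<in> topspace X"
    using S psi_S_open pq openin_subset by blast+
  with False obtain Y Y' where Y: "openin X Y" "openin X Y'" "psi p x \<in> Y" "psi q y \<in> Y'" "disjnt Y Y'"
    using X unfolding Hausdorff_space_def by meson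
  obtain A where A: "openin (U p) A" "x \<in> A" "\<forall>w\<in>A \<inter> S p. psi p w \<in> Y"
    by (rule psi_nbhd[OF pq(1) S(1) Y(1,3)])
  obtain B where B: "openin (U q) B" "y \<in> B" "\<forall>w\<in>B \<inter> S q. psi q w \<in> Y'"
    by (rule psi_nbhd[OF pq(2) S(2) Y(2,4)])
  have "(p, x) \<in> topspace T" "(q, y) \<in> topspace T"
    using x y pq C_topspace by auto
  moreover have "((p, x), (q, y)) \<notin> G" using G_psi[OF pq(1,2) x y] False by blast
  ultimately obtain A' B' where AB': "openin T A'" "openin T B'" "(p, x) \<in> A'" "(q, y) \<in> B'"
    "\<forall>a\<in>A'. \<forall>b\<in>B'. (a, b) \<notin> G"
    by (rule not_G_near)
  have op: "openin (U p) {v. (p, v) \<in> A'}" "openin (U q) {w. (q, w) \<in> B'}"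
    using AB' pq by (auto simp: openin_sum_topology)
  have lk: "w \<in> Om p q" if v: "v \<in> A \<inter> {v. (p, v) \<in> A'}" and w: "w \<in> B \<inter> {w. (q, w) \<in> B'}" and "linked p q v w" for v w
  proof -
    have "((p, v), (q, w)) \<notin> G" using AB'(5) v w by blast
    then have "\<not> (w \<in> D p q \<and> v = phi p q w)" using G_iff[OF pq] by blast
    then have "v \<in> S p" "w \<in> S q" "psi p v = psi q w" using \<open>linked p q v w\<close> by (auto simp: linked_def)
    then have "psi p v \<in> Y" "psi p v \<in> Y'" using A(3) B(3) v w by force+
    then show ?thesis using Y(5) by (auto simp: disjnt_def)
  qed
  show thesis
    by (rule that[of "A \<inter> {v. (p, v) \<in> A'}" "B \<inter> {w. (q, w) \<in> B'}"])
      (use A B AB' op lk in \<open>auto intro: openin_Int\<close>)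
qed

lemma linked_nbhd:
  obtains N where "openin T N" "Sigma P C \<subseteq> N"
    "\<forall>p q x y. le q p \<and> (p, x) \<in> N \<and> (q, y) \<in> N \<and> linked p q x y \<longrightarrow> y \<in> Om p q"
proof -
  \<comment> \<open>The third argument is a dummy that lets the tube lemma for triples handle a
    condition on pairs.\<close>
  let ?Q = "\<lambda>a b (c :: 'p \<times> 'u). le (fst b) (fst a) \<and> linked (fst a) (fst b) (snd a) (snd b) \<longrightarrow>
      snd b \<in> Om (fst a) (fst b)"
  have near: "\<exists>A B E. openin T A \<and> openin T B \<and> openin T E \<and> a \<in> A \<and> b \<in> B \<and> c \<in> E \<and>
        (\<forall>x\<in>A. \<forall>y\<in>B. \<forall>z\<in>E. ?Q x y z)"
    if abc: "a \<in> Sigma P C" "b \<in> Sigma P C" "c \<in> Sigma P C" for a b c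
  proof -
    obtain p x q y where a: "a = (p, x)" and b: "b = (q, y)" by (metis surj_pair)
    have m: "p \<in> P" "q \<in> P" "x \<in> C p" "y \<in> C q"
      using abc a b by auto
    have c: "c \<in> topspace T" "openin T (topspace T)"
      using abc compactin_subset_topspace[OF core_compact] by blast+
    show ?thesis
    proof (cases "le q p")
      case True
      obtain A B where "openin (U p) A" "openin (U q) B" "x \<in> A" "y \<in> B"
        "\<forall>v\<in>A. \<forall>w\<in>B. linked p q v w \<longrightarrow> w \<in> Om p q"
        by (rule linked_near[OF m(1,2) True m(3,4)])
      then show ?thesis
        unfolding a b using c m
        by - (rule exI[of _ "Pair p ` A"], rule exI[of _ "Pair q ` B"], rule exI[of _ "topspace T"],
          auto intro: component_open simp del: topspace_sum_topology)
    next
      case False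
      then show ?thesis
        unfolding a b using c m C_topspace
        by - (rule exI[of _ "Pair p ` topspace (U p)"], rule exI[of _ "Pair q ` topspace (U q)"],
          rule exI[of _ "topspace T"], auto intro: component_open)
    qed
  qed
  obtain N where N: "openin T N" "Sigma P C \<subseteq> N" "\<forall>a\<in>N. \<forall>b\<in>N. \<forall>c\<in>N. ?Q a b c"
    by (rule compact_tube3[OF core_compact near])
  show thesis
    by (rule that[OF N(1,2)]) (use N(3) in force)
qed

end

section \<open>Choice of the shrunken charts\<close>

text \<open>\<open>V p\<close> is the shrunken chart and \<open>L p\<close> a compact set around it.
  \<open>L_Om\<close> puts \<open>L p\<close> into \<open>D p p\<close>, where \<open>G\<close> is
  reflexive; \<open>L_trans\<close> gives transitivity on \<open>Sigma P L\<close>, and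
  \<open>L_linked\<close> keeps the overlaps inside \<open>Om\<close>.\<close>

locale shrunk_core = compact_core X Z P le U S psi Upq phi C Om D
  for X :: "'x topology" and Z :: "'x set"
    and P :: "'p set" and le :: "'p \<Rightarrow> 'p \<Rightarrow> bool"
    and U :: "'p \<Rightarrow> 'u topology" and S :: "'p \<Rightarrow> 'u set" and psi :: "'p \<Rightarrow> 'u \<Rightarrow> 'x"
    and Upq :: "'p \<Rightarrow> 'p \<Rightarrow> 'u set" and phi :: "'p \<Rightarrow> 'p \<Rightarrow> 'u \<Rightarrow> 'u"
    and C :: "'p \<Rightarrow> 'u set" and Om D :: "'p \<Rightarrow> 'p \<Rightarrow> 'u set" +
  fixes V L :: "'p \<Rightarrow> 'u set"
  assumes V_open: "\<And>p. p \<in> P \<Longrightarrow> openin (U p) (V p)" and L_compact: "\<And>p. p \<in> P \<Longrightarrow> compactin (U p) (L p)"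
    and C_V: "\<And>p. p \<in> P \<Longrightarrow> C p \<subseteq> V p" and V_L: "\<And>p. p \<in> P \<Longrightarrow> V p \<subseteq> L p"
    and L_Om: "\<And>p. p \<in> P \<Longrightarrow> L p \<subseteq> Om p p"
    and L_trans: "\<And>a b c. a \<in> Sigma P L \<Longrightarrow> b \<in> Sigma P L \<Longrightarrow> c \<in> Sigma P L \<Longrightarrow> (a, b) \<in> G \<Longrightarrow> (b, c) \<in> G \<Longrightarrow> (a, c) \<in> G"
    and L_linked: "\<And>p q x y. p \<in> P \<Longrightarrow> q \<in> P \<Longrightarrow> le q p \<Longrightarrow> x \<in> L p \<Longrightarrow> y \<in> L q \<Longrightarrow> linked p q x y \<Longrightarrow> y \<in> Om p q"

lemma (in compact_core) core_shrinking:
  obtains V L where "shrunk_core X Z P le U S psi Upq phi C Om D V L"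
proof -
  obtain N where N: "openin T N" "Sigma P C \<subseteq> N"
    and N_trans: "\<forall>a\<in>N. \<forall>b\<in>N. \<forall>c\<in>N. (a, b) \<in> G \<and> (b, c) \<in> G \<longrightarrow> (a, c) \<in> G"
    by (rule G_trans_nbhd)
  obtain M where M: "openin T M" "Sigma P C \<subseteq> M"
    and M_linked: "\<forall>p q x y. le q p \<and> (p, x) \<in> M \<and> (q, y) \<in> M \<and> linked p q x y \<longrightarrow> y \<in> Om p q"
    by (rule linked_nbhd)
  have "\<exists>V L. openin (U p) V \<and> compactin (U p) L \<and> C p \<subseteq> V \<and> V \<subseteq> L \<and> L \<subseteq> Om p p \<and> Pair p ` L \<subseteq> N \<inter> M"
    if p: "p \<in> P" for p
  proof -
    let ?O = "Om p p \<inter> ({x. (p, x) \<in> N} \<inter> {x. (p, x) \<in> M})"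
    have "openin (U p) ?O"
      using N M p le_refl Om_open by (intro openin_Int) (auto simp: openin_sum_topology)
    \<comment> \<open>Taking both indices equal in \<open>Om_core\<close> puts \<open>C p\<close>
      inside \<open>Om p p\<close>.\<close>
    moreover have "C p \<subseteq> ?O"
      using N M p Om_core[OF p p le_refl[OF p]] by auto
    ultimately obtain V L where "openin (U p) V" "compactin (U p) L" "C p \<subseteq> V" "V \<subseteq> L" "L \<subseteq> ?O"
      by (rule compact_open_sandwich[OF U_lc[OF p] U_Hausdorff[OF p] C(1)[OF p]])
    then show ?thesis by (intro exI[of _ V] exI[of _ L]) auto
  qed
  then obtain V L where VL: "\<And>p. p \<in> P \<Longrightarrow> openin (U p) (V p) \<and> compactin (U p) (L p) \<and> C p \<subseteq> V p \<and>
      V p \<subseteq> L p \<and> L p \<subseteq> Om p p \<and> Pair p ` L p \<subseteq> N \<inter> M"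
    by metis
  then have sub: "Sigma P L \<subseteq> N" "Sigma P L \<subseteq> M" by auto
  show thesis
  proof (rule that[of V L], unfold_locales)
    fix a b c assume "a \<in> Sigma P L" "b \<in> Sigma P L" "c \<in> Sigma P L" "(a, b) \<in> G" "(b, c) \<in> G"
    then show "(a, c) \<in> G" using N_trans sub by blast
  next
    fix p q x y assume "p \<in> P" "q \<in> P" "le q p" "x \<in> L p" "y \<in> L q" "linked p q x y"
    then show "y \<in> Om p q" using M_linked sub by blast
  qed (use VL in auto)
qed

section \<open>The shrunken system in the weak sense\<close>

context shrunk_core
begin

text \<open>Membership in \<open>Om p q\<close> keeps the closure within the compact
  \<open>D p q\<close>; the condition on \<open>phi p q y\<close> makes the restricted map land in
  the shrunken chart.\<close>

definition W :: "'p \<Rightarrow> 'p \<Rightarrow> 'u set" where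
  "W p q = {y \<in> V q \<inter> Om p q. phi p q y \<in> V p}"

lemma Om_Upq: "p \<in> P \<Longrightarrow> q \<in> P \<Longrightarrow> le q p \<Longrightarrow> Om p q \<subseteq> Upq p q"
  using Om_D D_Upq by blast

lemma W_open:
  assumes "p \<in> P" "q \<in> P" "le q p"
  shows "openin (U q) (W p q)"
  unfolding W_def using assms Om_Upq[OF assms] V_open Om_open
  by (intro phi_vimage_open) (auto intro: openin_Int)

lemma W_Upq: "p \<in> P \<Longrightarrow> q \<in> P \<Longrightarrow> le q p \<Longrightarrow> W p q \<subseteq> Upq p q"
  using Om_Upq by (auto simp: W_def)

lemma V_topspace: "p \<in> P \<Longrightarrow> V p \<subseteq> topspace (U p)"
  using V_open openin_subset by blast

text \<open>\<open>V p\<close> already lies in \<open>Om p p\<close>, and \<open>phi p p\<close> is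
  the identity.\<close>

lemma W_refl:
  assumes "p \<in> P"
  shows "W p p = V p"
  using V_L[OF assms] L_Om[OF assms] phi_refl[OF assms] V_topspace[OF assms] by (auto simp: W_def subset_iff)

lemma V_shrinking: "p \<in> P \<Longrightarrow> shrinking_in (U p) (topspace (U p)) (V p)"
  using shrinking_in_compact U_Hausdorff V_open V_L L_compact compactin_subset_topspace by metis

lemma W_shrinking:
  assumes "p \<in> P" "q \<in> P" "le q p"
  shows "shrinking_in (U q) (Upq p q) (W p q)"
  by (rule shrinking_in_compact[where K = "D p q"])
    (use assms Om_D[OF assms] W_open D_compact D_Upq U_Hausdorff in \<open>auto simp: W_def\<close>)

lemma shrunk_chart:
  assumes p: "p \<in> P"
  shows "K_chart X (subtopology (U p) (V p)) (S p \<inter> V p) (psi p)"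
  unfolding K_chart_def lcsm_space_def
proof (intro conjI)
  show "locally_compact_space (subtopology (U p) (V p))"
    using U_Hausdorff U_lc V_open p locally_compact_space_open_subset by blast
  show "separable_space (subtopology (U p) (V p))"
    using U_sep V_open p separable_space_open_subset by blast
  show "metrizable_space (subtopology (U p) (V p))"
    using U_metrizable p metrizable_space_subtopology by blast
  show "closedin (subtopology (U p) (V p)) (S p \<inter> V p)"
    using S_closed[OF p] by (auto simp: closedin_subtopology)
  have ts: "topspace (subtopology (U p) (S p)) = S p"
    using closedin_subset[OF S_closed[OF p]] by auto
  have tX: "topspace (subtopology X (psi p ` S p)) = psi p ` S p"
    using openin_subset[OF psi_S_open[OF p]] by auto
  have "openin (subtopology (U p) (S p)) (S p \<inter> V p)"
    using V_open[OF p] by (auto simp: openin_subtopology)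
  then have "openin (subtopology X (psi p ` S p)) (psi p ` (S p \<inter> V p))"
    using homeomorphic_imp_open_map[OF psi_homeo[OF p]] by (auto simp: open_map_def)
  then show "openin X (psi p ` (S p \<inter> V p))"
    using openin_trans_full psi_S_open[OF p] by blast
  have "psi p ` (topspace (subtopology (U p) (S p)) \<inter> V p)
      = topspace (subtopology X (psi p ` S p)) \<inter> psi p ` (S p \<inter> V p)"
    unfolding ts tX by blast
  from homeomorphic_map_subtopologies[OF psi_homeo[OF p] this]
  show "homeomorphic_map (subtopology (subtopology (U p) (V p)) (S p \<inter> V p))
     (subtopology X (psi p ` (S p \<inter> V p))) (psi p)"
    by (simp add: subtopology_subtopology Int_ac Int_absorb1 image_mono)
qed

text \<open>Openness, embedding and compatibility are inherited by restriction. The overlap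
  condition needs the choice of \<open>L\<close>: a common image in \<open>X\<close> forces
  \<open>y\<close> into the shrunken domain.\<close>

lemma shrunk_change:
  assumes pq: "p \<in> P" "q \<in> P" "le q p"
  shows "coord_change (subtopology (U q) (V q)) (S q \<inter> V q) (psi q)
     (subtopology (U p) (V p)) (S p \<inter> V p) (psi p) (W p q) (phi p q)"
  unfolding coord_change_def
proof (intro conjI ballI)
  have WV: "W p q \<subseteq> V q" by (auto simp: W_def)
  have WU: "y \<in> Upq p q" if "y \<in> W p q" for y using W_Upq[OF pq] that by blast
  show "openin (subtopology (U q) (V q)) (W p q)"
    using W_open[OF pq] WV by (metis inf.absorb2 openin_subtopology_Int2)
  have "embedding_map (subtopology (U q) (W p q)) (U p) (phi p q)"
    using embedding_map_subset[OF phi_emb[OF pq] W_Upq[OF pq]] .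
  then show "embedding_map (subtopology (subtopology (U q) (V q)) (W p q)) (subtopology (U p) (V p)) (phi p q)"
    using WV by (auto simp: embedding_map_in_subtopology subtopology_subtopology Int_absorb1 W_def)
  show "S q \<inter> V q \<inter> W p q = {x \<in> W p q. phi p q x \<in> S p \<inter> V p}"
    using phi_S[OF pq] WU by (auto simp: W_def)
  show "psi p (phi p q x) = psi q x" if "x \<in> S q \<inter> V q \<inter> W p q" for x
    using psi_phi[OF pq] WU that by auto
  show "psi q ` (S q \<inter> V q \<inter> W p q) = psi q ` (S q \<inter> V q) \<inter> psi p ` (S p \<inter> V p)"
  proof (intro equalityI subsetI)
    fix z assume "z \<in> psi q ` (S q \<inter> V q \<inter> W p q)"
    then obtain y where y: "y \<in> S q" "y \<in> V q" "y \<in> W p q" "z = psi q y" by blast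
    then have "phi p q y \<in> S p \<inter> V p" "z = psi p (phi p q y)"
      using phi_S[OF pq] psi_phi[OF pq] WU by (auto simp: W_def)
    then show "z \<in> psi q ` (S q \<inter> V q) \<inter> psi p ` (S p \<inter> V p)" using y by blast
  next
    fix z assume "z \<in> psi q ` (S q \<inter> V q) \<inter> psi p ` (S p \<inter> V p)"
    then obtain x y where xy: "x \<in> S p" "x \<in> V p" "y \<in> S q" "y \<in> V q" "z = psi q y" "psi p x = psi q y"
      by (auto simp: image_iff)
    \<comment> \<open>This is the second alternative of \<open>linked\<close>. Injectivity of
      \<open>psi p\<close> then identifies \<open>phi p q y\<close> with \<open>x\<close>, which
      lies in \<open>V p\<close>.\<close>
    then have "y \<in> Om p q"
      using L_linked[OF pq, of x y] V_L pq unfolding linked_def by blast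
    moreover from this have "phi p q y = x"
      using Om_Upq[OF pq] phi_S[OF pq] psi_phi[OF pq] xy psi_inj[OF pq(1)] by (metis inj_onD subsetD)
    ultimately show "z \<in> psi q ` (S q \<inter> V q \<inter> W p q)"
      using xy by (auto simp: W_def)
  qed
qed

text \<open>The cocycle condition and comparability pass to smaller domains; the cover of
  \<open>Z\<close> survives because each \<open>V p\<close> still contains the core
  \<open>C p\<close>.\<close>

lemma shrunk_weak: "gcs_weak X Z P le (\<lambda>p. subtopology (U p) (V p)) (\<lambda>p. S p \<inter> V p) psi W phi"
  unfolding gcs_weak_def
proof (intro conjI)
  show "finite P" "partial_order_on_set P le" using weak by (auto simp: gcs_weak_def)
  show "\<forall>p\<in>P. \<forall>q\<in>P. \<forall>r\<in>P. le r q \<and> le q p \<longrightarrow>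
     (\<forall>x\<in>W q r \<inter> W p r. phi q r x \<in> W p q \<longrightarrow> phi p r x = phi p q (phi q r x))"
  proof (intro ballI impI; elim conjE)
    fix p q r x
    assume "p \<in> P" "q \<in> P" "r \<in> P" "le r q" "le q p" "x \<in> W q r \<inter> W p r" "phi q r x \<in> W p q"
    then show "phi p r x = phi p q (phi q r x)"
      using cocycle[of p q r x] W_Upq[of q r] W_Upq[of p r] W_Upq[of p q] le_trans[of r q p] by blast
  qed
  show "\<forall>p\<in>P. \<forall>q\<in>P. psi p ` (S p \<inter> V p) \<inter> psi q ` (S q \<inter> V q) \<noteq> {} \<longrightarrow> le p q \<or> le q p"
  proof (intro ballI impI)
    fix p q assume pq: "p \<in> P" "q \<in> P" and "psi p ` (S p \<inter> V p) \<inter> psi q ` (S q \<inter> V q) \<noteq> {}"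
    then obtain x y where "x \<in> S p" "y \<in> S q" "psi p x = psi q y" by auto
    then show "le p q \<or> le q p" using comparable pq by blast
  qed
  show "Z \<subseteq> (\<Union>p\<in>P. psi p ` (S p \<inter> V p))"
  proof (rule order_trans[OF core_cover], intro UN_mono image_mono)
    show "C p \<subseteq> S p \<inter> V p" if "p \<in> P" for p using C(2) C_V that by simp
  qed simp
  have "phi p p x = x" if "p \<in> P" "x \<in> V p" for p x
    using phi_refl[OF that(1) subsetD[OF V_topspace[OF that(1)] that(2)]] .
  then show "\<forall>p\<in>P. W p p = topspace (subtopology (U p) (V p)) \<and> (\<forall>x\<in>topspace (subtopology (U p) (V p)). phi p p x = x)"
    using W_refl by (simp add: Int_absorb1[OF V_topspace])
qed (use shrunk_chart shrunk_change in auto)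

section \<open>The identification relation and the Hausdorff quotient\<close>

lemma G_refl:
  assumes "a \<in> Sigma P L"
  shows "(a, a) \<in> G"
proof -
  obtain p x where a: "a = (p, x)" "p \<in> P" "x \<in> L p" using assms by blast
  then have "x \<in> D p p" using L_Om Om_D le_refl by blast
  moreover have "phi p p x = x"
    using a L_compact compactin_subset_topspace phi_refl by blast
  ultimately show ?thesis using a G_iff le_refl by auto
qed

lemma equiv_G_restrict:
  assumes "A \<subseteq> Sigma P L"
  shows "equiv A (G \<inter> A \<times> A)"
proof (rule equivI)
  show "refl_on A (G \<inter> A \<times> A)" using G_refl assms by (auto intro!: refl_onI)
  show "sym (G \<inter> A \<times> A)" using G_sym by (auto intro!: symI)
  show "trans (G \<inter> A \<times> A)" using L_trans assms by (intro transI) blast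
qed simp

text \<open>\<open>G\<close> places \<open>y\<close> only in \<open>D p q\<close>; the first
  alternative of \<open>linked\<close> improves this to \<open>Om p q\<close>. Thus on the shrunken
  charts the compact domains and the open ones define the same relation.\<close>

lemma W_G:
  assumes pq: "p \<in> P" "q \<in> P" "le q p" and "x \<in> V p" "y \<in> V q"
  shows "y \<in> W p q \<and> x = phi p q y \<longleftrightarrow> ((p, x), (q, y)) \<in> G"
proof
  show "((p, x), (q, y)) \<in> G" if "y \<in> W p q \<and> x = phi p q y"
    using that Om_D[OF pq] unfolding G_iff[OF pq] by (auto simp: W_def)
  show "y \<in> W p q \<and> x = phi p q y" if "((p, x), (q, y)) \<in> G"
  proof -
    have yx: "y \<in> D p q" "x = phi p q y" using that unfolding G_iff[OF pq] by auto
    then have "y \<in> Om p q"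
      using L_linked[OF pq, of x y] V_L pq assms unfolding linked_def by blast
    then show ?thesis using yx assms by (auto simp: W_def)
  qed
qed

text \<open>Reflexivity of \<open>G\<close> absorbs the diagonal clause, and \<open>W_G\<close> in
  the two orientations accounts for the others.\<close>

lemma gcs_rel_eq:
  "gcs_rel P le (\<lambda>p. subtopology (U p) (V p)) W phi = G \<inter> Sigma P V \<times> Sigma P V"
proof -
  have "((p, x), (q, y)) \<in> gcs_rel P le (\<lambda>p. subtopology (U p) (V p)) W phi \<longleftrightarrow> ((p, x), (q, y)) \<in> G"
    if "p \<in> P" "q \<in> P" "x \<in> V p" "y \<in> V q" for p x q y
  proof -
    have "((p, x), (q, y)) \<in> gcs_rel P le (\<lambda>p. subtopology (U p) (V p)) W phi \<longleftrightarrow>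
        (p = q \<and> x = y) \<or> (le p q \<and> x \<in> W q p \<and> y = phi q p x) \<or> (le q p \<and> y \<in> W p q \<and> x = phi p q y)"
      using that V_topspace by (auto simp: gcs_rel_def)
    also have "\<dots> \<longleftrightarrow> (p = q \<and> x = y) \<or> (le p q \<and> ((q, y), (p, x)) \<in> G) \<or> (le q p \<and> ((p, x), (q, y)) \<in> G)"
      using W_G that by blast
    also have "\<dots> \<longleftrightarrow> ((p, x), (q, y)) \<in> G"
    proof -
      have "((p, x), (p, x)) \<in> G" using G_refl that V_L by blast
      moreover have "le p q \<or> le q p" if "((p, x), (q, y)) \<in> G" using that unfolding G_def by blast
      ultimately show ?thesis using G_sym by blast
    qed
    finally show ?thesis .
  qed
  moreover have "gcs_rel P le (\<lambda>p. subtopology (U p) (V p)) W phi \<subseteq> Sigma P V \<times> Sigma P V"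
    by (auto simp: gcs_rel_def)
  ultimately show ?thesis by auto
qed

text \<open>On the compact Hausdorff space \<open>Sigma P L\<close> the relation \<open>G\<close> is
  a closed equivalence relation, so the quotient of its subset \<open>Sigma P V\<close> is
  Hausdorff.\<close>

lemma shrunk_strong: "gcs_strong X Z P le (\<lambda>p. subtopology (U p) (V p)) (\<lambda>p. S p \<inter> V p) psi W phi"
proof -
  let ?L = "Sigma P L" and ?V = "Sigma P V"
  let ?TL = "subtopology T ?L"
  have VL: "?V \<subseteq> ?L" using V_L by auto
  have L: "compactin T ?L" using L_compact fin by (intro compactin_sum_topology_Sigma)
  then have tL: "topspace ?TL = ?L" using compactin_subset_topspace by fastforce
  have "compact_space ?TL" using L compactin_subspace by blast
  moreover have "Hausdorff_space ?TL" using T_Hausdorff Hausdorff_space_subtopology by blast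
  moreover have "equiv (topspace ?TL) (G \<inter> ?L \<times> ?L)" unfolding tL by (rule equiv_G_restrict) simp
  moreover have "closedin (prod_topology ?TL ?TL) (G \<inter> ?L \<times> ?L)"
    using G_closed unfolding subtopology_Times[symmetric] closedin_subtopology by blast
  moreover have "?V \<subseteq> topspace ?TL" using VL tL by simp
  ultimately have "Hausdorff_space (quotient_topology (subtopology ?TL ?V) ((G \<inter> ?L \<times> ?L) \<inter> ?V \<times> ?V))"
    by (rule Hausdorff_space_quotient_subset)
  \<comment> \<open>The subspace \<open>Sigma P V\<close> of the sum is the sum of the shrunken
    charts, which is the space that \<open>gcs_strong\<close> speaks of.\<close>
  moreover have "subtopology ?TL ?V = subtopology T ?V"
    by (simp only: subtopology_subtopology Int_absorb1[OF VL])
  then have "subtopology ?TL ?V = sum_topology (\<lambda>p. subtopology (U p) (V p)) P"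
    by (simp only: subtopology_sum_topology)
  moreover have "(G \<inter> ?L \<times> ?L) \<inter> ?V \<times> ?V = G \<inter> ?V \<times> ?V" using VL by blast
  ultimately have "Hausdorff_space (quotient_topology (sum_topology (\<lambda>p. subtopology (U p) (V p)) P) (G \<inter> ?V \<times> ?V))"
    by simp
  moreover have "topspace (sum_topology (\<lambda>p. subtopology (U p) (V p)) P) = ?V"
    using V_topspace by (auto simp: subset_iff)
  ultimately show ?thesis
    unfolding gcs_strong_def gcs_rel_eq using shrunk_weak equiv_G_restrict[OF VL] by simp
qed

end

section \<open>Choice of the compact core and assembly\<close>

theorem theorem2p9:
  fixes X :: "'x topology" and Z :: "'x set"
    and P :: "'p set" and le :: "'p \<Rightarrow> 'p \<Rightarrow> bool"
    and U :: "'p \<Rightarrow> 'u topology" and S :: "'p \<Rightarrow> 'u set" and psi :: "'p \<Rightarrow> 'u \<Rightarrow> 'x"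
    and Upq :: "'p \<Rightarrow> 'p \<Rightarrow> 'u set" and phi :: "'p \<Rightarrow> 'p \<Rightarrow> 'u \<Rightarrow> 'u"
  assumes "lcsm_space X"
    and "compactin X Z"
    and "gcs_weak X Z P le U S psi Upq phi"
  shows "\<exists>V :: 'p \<Rightarrow> 'u set. \<exists>W :: 'p \<Rightarrow> 'p \<Rightarrow> 'u set.
           (\<forall>p\<in>P. shrinking_in (U p) (topspace (U p)) (V p)) \<and>
           (\<forall>p\<in>P. \<forall>q\<in>P. le q p \<longrightarrow> shrinking_in (U q) (Upq p q) (W p q)) \<and>
           gcs_strong X Z P le (\<lambda>p. subtopology (U p) (V p)) (\<lambda>p. S p \<inter> V p) psi W phi"
proof -
  have X: "locally_compact_space X" "Hausdorff_space X"
    using assms(1) metrizable_imp_Hausdorff_space by (auto simp: lcsm_space_def)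
  note weak = assms(3)
  have chart: "lcsm_space (U p)" "closedin (U p) (S p)" "openin X (psi p ` S p)"
    "homeomorphic_map (subtopology (U p) (S p)) (subtopology X (psi p ` S p)) (psi p)" if "p \<in> P" for p
    using weak that by (auto simp: gcs_weak_def K_chart_def)
  have UH: "Hausdorff_space (U p)" "locally_compact_space (U p)" if "p \<in> P" for p
    using chart(1)[OF that] metrizable_imp_Hausdorff_space by (auto simp: lcsm_space_def)
  have "Z \<subseteq> (\<Union>p\<in>P. psi p ` S p)" using weak by (simp add: gcs_weak_def)
  then obtain K where K: "\<And>p. p \<in> P \<Longrightarrow> compactin X (K p)" "\<And>p. p \<in> P \<Longrightarrow> K p \<subseteq> psi p ` S p"
    and ZK: "Z \<subseteq> (\<Union>p\<in>P. K p)"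
    using compact_cover_refinement[OF X assms(2), of P "\<lambda>p. psi p ` S p"] chart(3) by blast
  \<comment> \<open>The core is the pullback under \<open>psi p\<close> of a compact cover of
    \<open>Z\<close> subordinate to the open images of the charts.\<close>
  define C where "C p = {x \<in> S p. psi p x \<in> K p}" for p
  have psi_C: "psi p ` C p = K p" if "p \<in> P" for p
    using K(2)[OF that] by (auto simp: C_def)
  have C_im: "compactin (U q) {y \<in> S q. psi q y \<in> K'}" if "q \<in> P" "compactin X K'" "K' \<subseteq> psi q ` S q" for q K'
  proof -
    have "topspace (subtopology (U q) (S q)) = S q"
      using closedin_subset[OF chart(2)[OF that(1)]] by auto
    moreover have "psi q ` {y \<in> S q. psi q y \<in> K'} = K'" using that(3) by auto
    moreover have "compactin (subtopology X (psi q ` S q)) K'" using that by (simp add: compactin_subtopology)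
    ultimately have "compactin (subtopology (U q) (S q)) {y \<in> S q. psi q y \<in> K'}"
      using homeomorphic_map_compactness[OF chart(4)[OF that(1)], of "{y \<in> S q. psi q y \<in> K'}"] by auto
    then show ?thesis by (simp add: compactin_subtopology)
  qed
  \<comment> \<open>The innermost set consists of the points of \<open>C q\<close> that agree in
    \<open>X\<close> with a point of \<open>C p\<close>; \<open>A\<close> and \<open>B\<close>
    become \<open>Om p q\<close> and \<open>D p q\<close>.\<close>
  define nbd where "nbd p q A B \<longleftrightarrow> openin (U q) A \<and> compactin (U q) B \<and>
      {y \<in> S q. psi q y \<in> K p \<inter> K q} \<subseteq> A \<and> A \<subseteq> B \<and> B \<subseteq> Upq p q" for p q A B
  have "\<exists>A B. nbd p q A B" if pq: "p \<in> P" "q \<in> P" "le q p" for p q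
  proof -
    have cc: "coord_change (U q) (S q) (psi q) (U p) (S p) (psi p) (Upq p q) (phi p q)"
      using weak pq by (simp add: gcs_weak_def)
    have "compactin X (K p \<inter> K q)"
      using K(1) pq X(2) by (metis compactin_imp_closedin closed_Int_compactin)
    then have 1: "compactin (U q) {y \<in> S q. psi q y \<in> K p \<inter> K q}"
      using C_im[OF pq(2)] K(2)[OF pq(2)] by (metis inf.coboundedI2)
    have inj: "inj_on (psi q) (S q)"
      using homeomorphic_imp_injective_map[OF chart(4)[OF pq(2)]] closedin_subset[OF chart(2)[OF pq(2)]]
      by (simp add: Int_absorb1)
    \<comment> \<open>The overlap condition writes \<open>psi q y\<close> as the image of a point of
      \<open>Upq p q\<close>, and injectivity of \<open>psi q\<close> identifies that point with
      \<open>y\<close>.\<close>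
    have 2: "{y \<in> S q. psi q y \<in> K p \<inter> K q} \<subseteq> Upq p q"
    proof clarify
      fix y assume y: "y \<in> S q" "psi q y \<in> K p"
      then have "psi q y \<in> psi q ` S q \<inter> psi p ` S p" using K(2)[OF pq(1)] by blast
      moreover have "psi q ` (S q \<inter> Upq p q) = psi q ` S q \<inter> psi p ` S p"
        using cc unfolding coord_change_def by blast
      ultimately have "psi q y \<in> psi q ` (S q \<inter> Upq p q)" by (simp only:)
      then obtain y' where "y' \<in> S q" "y' \<in> Upq p q" "psi q y = psi q y'" by blast
      then show "y \<in> Upq p q" using inj_onD[OF inj] y(1) by metis
    qed
    have "openin (U q) (Upq p q)" using cc by (simp add: coord_change_def)
    then obtain A B where "openin (U q) A" "compactin (U q) B" "{y \<in> S q. psi q y \<in> K p \<inter> K q} \<subseteq> A" "A \<subseteq> B" "B \<subseteq> Upq p q"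
      by (rule compact_open_sandwich[OF UH(2,1)[OF pq(2)] 1 _ 2])
    then show ?thesis unfolding nbd_def by blast
  qed
  then obtain Om D where "\<And>p q. p \<in> P \<Longrightarrow> q \<in> P \<Longrightarrow> le q p \<Longrightarrow> nbd p q (Om p q) (D p q)"
    by metis
  then have OmD: "openin (U q) (Om p q)" "compactin (U q) (D p q)" "{y \<in> S q. psi q y \<in> K p \<inter> K q} \<subseteq> Om p q"
      "Om p q \<subseteq> D p q" "D p q \<subseteq> Upq p q" if "p \<in> P" "q \<in> P" "le q p" for p q
    using that unfolding nbd_def by blast+
  interpret compact_core X Z P le U S psi Upq phi C Om D
  proof
    show "compactin (U p) (C p)" if "p \<in> P" for p
      unfolding C_def using C_im K that by blast
    \<comment> \<open>The common image lies in both \<open>K p\<close> and \<open>K q\<close>, so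
      \<open>y\<close> belongs to the compact set around which \<open>Om p q\<close> was
      chosen.\<close>
    show "y \<in> Om p q" if "p \<in> P" "q \<in> P" "le q p" "x \<in> C p" "y \<in> C q" "psi p x = psi q y" for p q x y
      using OmD(3)[OF that(1-3)] that(4-6) by (auto simp: C_def)
    show "Z \<subseteq> (\<Union>p\<in>P. psi p ` C p)" using ZK psi_C by auto
  qed (use X weak OmD in \<open>auto simp: C_def\<close>)
  obtain V L where "shrunk_core X Z P le U S psi Upq phi C Om D V L"
    by (rule core_shrinking)
  then interpret shrunk_core X Z P le U S psi Upq phi C Om D V L .
  show ?thesis
    using V_shrinking W_shrinking shrunk_strong by blast
qed

end
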